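(* For any $c\in(0,1]$, there exists an OnlineMMS instance $\mathcal I=([n],[m],(v_i)_{i\in[n]})$ with binary-XOS valuations, where no randomized algorithm is $(c,\beta)$-competitive for any $\beta\ge 1-\frac{c}{2}$.
   Context: OnlineMMS problem: an instance $\mathcal I=([n],[m],(v_i)_{i\in[n]})$ consists of $n$ agents, $m$ indivisible goods $[m]$, and a non-negative non-decreasing valuation $v_i:2^{[m]}\to\mathbb{R}_+$ for each agent $i$. Agent $i$ arrives at time $i$; her valuation is then revealed and the algorithm must irrevocably allocate to her a subset $A_i$ of the goods not yet allocated. The algorithm knows $n$ and the set of goods in advance but has no information about the valuations of future agents. The valuations are chosen by an oblivious adversary, who knows the algorithm but not the outcomes of its random coin tosses. The maximin share of agent $i$ is $\mathrm{MMS}_i=\max_{(P_1,\dots,P_n)}\min_{\ell\in[n]} v_i(P_\ell)$, where the maximum is over all partitions of $[m]$ into $n$ bundles. For $\alpha,\beta\in[0,1]$, an online algorithm is $(\alpha,\beta)$-competitive if, with probability at least $\beta$, all agents $i$ simultaneously satisfy $v_i(A_i)\ge\alpha\,\mathrm{MMS}_i$. A valuation $v$ is XOS if $v(S)=\max_k a_k(S)$ for a finite collection of additive functions (clauses) $a_k$; it is binary-XOS if every item has value $0$ or $1$ in every clause. *)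

theory Defs
  imports "HOL-Probability.Probability"
begin

text \<open>
  Agents are \<open>{1..n}\<close>, goods are \<open>{1..m}\<close>. A valuation is a genuine function on
  \<open>Pow {1..m}\<close>: it is extensional, so values on other sets carry no information.
\<close>

type_synonym valuation = "nat set \<Rightarrow> real"

definition valuations :: "nat \<Rightarrow> valuation set" where
  "valuations m = {u \<in> Pow {1..m} \<rightarrow>\<^sub>E {0..}. mono_on (Pow {1..m}) u}"

definition online_mms_instance :: "nat \<Rightarrow> nat \<Rightarrow> (nat \<Rightarrow> valuation) \<Rightarrow> bool" where
  "online_mms_instance n m v \<longleftrightarrow> 1 \<le> n \<and> (\<forall>i\<in>{1..n}. v i \<in> valuations m)"

text \<open>A clause is given by its item values; the additive function is \<open>S \<mapsto> \<Sum>g\<in>S. a g\<close>.\<close>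

definition xos_clauses :: "nat \<Rightarrow> valuation \<Rightarrow> (nat \<Rightarrow> real) set \<Rightarrow> bool" where
  "xos_clauses m u K \<longleftrightarrow> finite K \<and> K \<noteq> {} \<and> (\<forall>a\<in>K. \<forall>g\<in>{1..m}. 0 \<le> a g) \<and>
     (\<forall>S. S \<subseteq> {1..m} \<longrightarrow> u S = (MAX a\<in>K. \<Sum>g\<in>S. a g))"

definition binary_xos :: "nat \<Rightarrow> valuation \<Rightarrow> bool" where
  "binary_xos m u \<longleftrightarrow> (\<exists>K. xos_clauses m u K \<and> (\<forall>a\<in>K. \<forall>g\<in>{1..m}. a g \<in> {0, 1}))"

text \<open>Bundles of a partition may be empty.\<close>

definition bundle_partition :: "nat \<Rightarrow> nat \<Rightarrow> (nat \<Rightarrow> nat set) \<Rightarrow> bool" where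
  "bundle_partition n m P \<longleftrightarrow> disjoint_family_on P {1..n} \<and> (\<Union>l\<in>{1..n}. P l) = {1..m}"

definition mms :: "nat \<Rightarrow> nat \<Rightarrow> valuation \<Rightarrow> real" where
  "mms n m u = (MAX P\<in>Collect (bundle_partition n m). MIN l\<in>{1..n}. u (P l))"

text \<open>
  A deterministic online algorithm maps the list of valuations revealed so far
  (including that of the arriving agent) to the bundle given to the arriving agent. Earlier
  bundles are determined by the prefixes of the list, so they need not be separate arguments.
  Bundles are disjoint from the earlier ones; goods may stay unallocated. The numbers
  \<open>n\<close> and \<open>m\<close> are fixed before the algorithm is chosen, so it knows them.
\<close>

type_synonym det_alg = "valuation list \<Rightarrow> nat set"

definition histories :: "nat \<Rightarrow> nat \<Rightarrow> valuation list set" where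
  "histories n m = {us. set us \<subseteq> valuations m \<and> 1 \<le> length us \<and> length us \<le> n}"

definition online_algorithm :: "nat \<Rightarrow> nat \<Rightarrow> det_alg \<Rightarrow> bool" where
  "online_algorithm n m D \<longleftrightarrow>
     (\<forall>us\<in>histories n m. D us \<subseteq> {1..m} - (\<Union>j\<in>{1..<length us}. D (take j us)))"

definition allotted :: "det_alg \<Rightarrow> (nat \<Rightarrow> valuation) \<Rightarrow> nat \<Rightarrow> nat set" where
  "allotted D v i = D (map v [1..<Suc i])"

text \<open>
  A randomized algorithm is a probability measure on deterministic online algorithms. The
  sigma-algebra is arbitrary, subject only to every single decision being a random variable.
  An algorithm using coin tosses from any probability space yields such a measure
  as the image of its coin tosses.
\<close>

definition randomized_algorithm :: "nat \<Rightarrow> nat \<Rightarrow> det_alg measure \<Rightarrow> bool" where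
  "randomized_algorithm n m M \<longleftrightarrow> prob_space M \<and> (\<forall>D\<in>space M. online_algorithm n m D) \<and>
     (\<forall>us\<in>histories n m. (\<lambda>D. D us) \<in> M \<rightarrow>\<^sub>M count_space (Pow {1..m}))"

definition competitive_on ::
  "nat \<Rightarrow> nat \<Rightarrow> (nat \<Rightarrow> valuation) \<Rightarrow> det_alg measure \<Rightarrow> real \<Rightarrow> real \<Rightarrow> bool" where
  "competitive_on n m v M \<alpha> \<beta> \<longleftrightarrow>
     \<beta> \<le> measure M {D \<in> space M. \<forall>i\<in>{1..n}. \<alpha> * mms n m (v i) \<le> v i (allotted D v i)}"

end

theory Submission
  imports Defs
begin

text \<open>
  For \<open>c < 1\<close> take \<open>n = \<lfloor>1/c\<rfloor> + 1\<close> and \<open>n\<^sup>2\<close> goods, split into \<open>n\<close> rows of \<open>n\<close> goods. Agent 1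
  counts the goods she gets within her best row, so \<open>c n > 1\<close> forces her to take two goods of some
  row. All later agents are unit-demand on one common row \<open>j\<close>, and the \<open>n - 1\<close> of them cannot be
  served if two goods of row \<open>j\<close> are gone. Since agent 1 does not know \<open>j\<close>, no deterministic
  algorithm succeeds for all \<open>n\<close> choices of \<open>j\<close>, so by a union bound some \<open>j\<close> makes the success
  probability at most \<open>1 - 1/n < 1 - c/2\<close>. For \<open>c = 1\<close> the last inequality is not strict; there
  two agents, valuing the rows and the columns of a \<open>2 \<times> 2\<close> grid, can never both be satisfied.
\<close>

section \<open>Overlap valuations and their maximin shares\<close>

text \<open>This is the binary-XOS function whose clauses are the indicators of \<open>F 1\<close>,
  ..., \<open>F n\<close>. Every agent of the construction gets such a valuation; only the family
  \<open>F\<close> varies. The restriction to \<open>Pow {1..m}\<close> supplies the extensionality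
  demanded by \<open>valuations\<close>.\<close>

definition max_overlap :: "nat \<Rightarrow> nat \<Rightarrow> (nat \<Rightarrow> nat set) \<Rightarrow> valuation" where
  "max_overlap n m F = (\<lambda>S\<in>Pow {1..m}. MAX l\<in>{1..n}. real (card (S \<inter> F l)))"

lemma max_overlap_ge:
  assumes "S \<subseteq> {1..m}" "l \<in> {1..n}"
  shows "real (card (S \<inter> F l)) \<le> max_overlap n m F S"
  using assms unfolding max_overlap_def by (auto intro!: Max_ge)

lemma max_overlap_attained:
  assumes "S \<subseteq> {1..m}" "1 \<le> n"
  obtains l where "l \<in> {1..n}" "max_overlap n m F S = real (card (S \<inter> F l))"
proof -
  have "(MAX l\<in>{1..n}. real (card (S \<inter> F l))) \<in> (\<lambda>l. real (card (S \<inter> F l))) ` {1..n}"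
    using assms(2) by (intro Max_in) auto
  then show thesis
    using that assms(1) unfolding max_overlap_def by auto
qed

lemma max_overlap_mono:
  assumes "S \<subseteq> T" "T \<subseteq> {1..m}" "1 \<le> n"
  shows "max_overlap n m F S \<le> max_overlap n m F T"
proof -
  obtain l where l: "l \<in> {1..n}" "max_overlap n m F S = real (card (S \<inter> F l))"
    using max_overlap_attained[of S m n F] assms by auto
  have "finite T"
    using assms(2) finite_subset by blast
  then have "card (S \<inter> F l) \<le> card (T \<inter> F l)"
    using assms(1) by (intro card_mono) auto
  then show ?thesis
    using l max_overlap_ge[OF assms(2) l(1), of F] by linarith
qed

lemma max_overlap_valuation:
  assumes "1 \<le> n"
  shows "max_overlap n m F \<in> valuations m"
proof -
  have "0 \<le> max_overlap n m F S" if "S \<subseteq> {1..m}" for S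
    using max_overlap_attained[OF that assms, of F] by (metis of_nat_0_le_iff)
  moreover have "mono_on (Pow {1..m}) (max_overlap n m F)"
    using max_overlap_mono assms by (auto intro!: mono_onI)
  ultimately show ?thesis
    unfolding valuations_def by (auto simp: max_overlap_def)
qed

lemma max_overlap_binary_xos:
  assumes "1 \<le> n"
  shows "binary_xos m (max_overlap n m F)"
proof -
  define K :: "(nat \<Rightarrow> real) set" where "K = (\<lambda>l g. of_bool (g \<in> F l)) ` {1..n}"
  have "max_overlap n m F S = (MAX a\<in>K. \<Sum>g\<in>S. a g)" if S: "S \<subseteq> {1..m}" for S
  proof -
    have "finite S"
      using S finite_subset by blast
    then have "(\<Sum>g\<in>S. of_bool (g \<in> F l)) = real (card (S \<inter> F l))" for l
      by (simp add: of_bool_def sum.If_cases)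
    then show ?thesis
      using S unfolding max_overlap_def K_def by (simp add: image_image)
  qed
  then have "xos_clauses m (max_overlap n m F) K"
    using assms unfolding xos_clauses_def K_def by auto
  moreover have "\<forall>a\<in>K. \<forall>g\<in>{1..m}. a g \<in> {0, 1}"
    unfolding K_def by auto
  ultimately show ?thesis
    unfolding binary_xos_def by blast
qed

text \<open>\<open>Max\<close> is only meaningful on finite sets, and there are infinitely many
  \<open>P\<close>, since a partition is unconstrained outside \<open>{1..n}\<close>. Each minimum,
  however, is a value of \<open>u\<close> on a subset of \<open>{1..m}\<close>, so only finitely
  many minima occur.\<close>

lemma mms_ge:
  assumes "1 \<le> n" "bundle_partition n m P" "\<And>l. l \<in> {1..n} \<Longrightarrow> x \<le> u (P l)"
  shows "x \<le> mms n m u"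
proof -
  have in_image: "(MIN l\<in>{1..n}. u (Q l)) \<in> u ` Pow {1..m}" if "bundle_partition n m Q" for Q
  proof -
    have "(MIN l\<in>{1..n}. u (Q l)) \<in> (\<lambda>l. u (Q l)) ` {1..n}"
      using assms(1) by (intro Min_in) auto
    then show ?thesis
      using that unfolding bundle_partition_def by blast
  qed
  have "(\<lambda>Q. MIN l\<in>{1..n}. u (Q l)) ` Collect (bundle_partition n m) \<subseteq> u ` Pow {1..m}"
    using in_image by blast
  then have "finite ((\<lambda>Q. MIN l\<in>{1..n}. u (Q l)) ` Collect (bundle_partition n m))"
    by (rule finite_subset) simp
  then have "(MIN l\<in>{1..n}. u (P l)) \<le> mms n m u"
    unfolding mms_def using assms(2) by (intro Max_ge) auto
  moreover have "x \<le> (MIN l\<in>{1..n}. u (P l))"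
    using assms(1,3) by (subst Min_ge_iff) auto
  ultimately show ?thesis
    by linarith
qed

text \<open>The sets \<open>F l\<close> become a partition once the uncovered goods are added to the
  first bundle; each bundle still contains its own \<open>F l\<close>.\<close>

lemma mms_max_overlap_ge:
  assumes n: "1 \<le> n" and sub: "\<And>l. l \<in> {1..n} \<Longrightarrow> F l \<subseteq> {1..m}"
    and disj: "disjoint_family_on F {1..n}"
    and card: "\<And>l. l \<in> {1..n} \<Longrightarrow> k \<le> card (F l)"
  shows "real k \<le> mms n m (max_overlap n m F)"
proof (rule mms_ge[OF n])
  define P where "P l = F l \<union> (if l = 1 then {1..m} - (\<Union>i\<in>{1..n}. F i) else {})" for l
  show "bundle_partition n m P"
    unfolding bundle_partition_def
  proof
    show "disjoint_family_on P {1..n}"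
      unfolding disjoint_family_on_def
    proof (intro ballI impI)
      fix i j assume ij: "i \<in> {1..n}" "j \<in> {1..n}" "i \<noteq> j"
      then have "F i \<inter> F j = {}"
        using disj unfolding disjoint_family_on_def by blast
      then show "P i \<inter> P j = {}"
        using ij unfolding P_def by auto
    qed
    show "(\<Union>l\<in>{1..n}. P l) = {1..m}"
    proof
      have "P l \<subseteq> {1..m}" if "l \<in> {1..n}" for l
        using sub[OF that] unfolding P_def by auto
      then show "(\<Union>l\<in>{1..n}. P l) \<subseteq> {1..m}"
        by (rule UN_least)
      have "{1..m} \<subseteq> (\<Union>l\<in>{1..n}. F l) \<union> P 1"
        by (auto simp: P_def)
      also have "\<dots> \<subseteq> (\<Union>l\<in>{1..n}. P l)"
      proof (intro Un_least UN_mono UN_upper)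
        show "F l \<subseteq> P l" for l
          by (simp add: P_def)
      qed (use n in auto)
      finally show "{1..m} \<subseteq> (\<Union>l\<in>{1..n}. P l)" .
    qed
  qed
  fix l assume l: "l \<in> {1..n}"
  have P: "P l \<subseteq> {1..m}"
    using sub[OF l] unfolding P_def by auto
  have "P l \<inter> F l = F l"
    unfolding P_def by auto
  then show "real k \<le> max_overlap n m F (P l)"
    using max_overlap_ge[OF P l, of F] card[OF l] by simp
qed

text \<open>The value of \<open>S\<close> is attained in a single clause, so a satisfied agent must
  hold a \<open>c\<close> fraction of \<open>k\<close> goods inside one set
  \<open>F l\<close>.\<close>

lemma satisfied_overlap:
  assumes n: "1 \<le> n" and "\<And>l. l \<in> {1..n} \<Longrightarrow> F l \<subseteq> {1..m}"
    and "disjoint_family_on F {1..n}" and "\<And>l. l \<in> {1..n} \<Longrightarrow> k \<le> card (F l)"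
    and c: "0 \<le> c" and S: "S \<subseteq> {1..m}"
    and sat: "c * mms n m (max_overlap n m F) \<le> max_overlap n m F S"
  obtains l where "l \<in> {1..n}" "c * real k \<le> real (card (S \<inter> F l))"
proof -
  obtain l where "l \<in> {1..n}" "max_overlap n m F S = real (card (S \<inter> F l))"
    using max_overlap_attained[OF S n] by metis
  moreover have "c * real k \<le> c * mms n m (max_overlap n m F)"
    using mms_max_overlap_ge[OF assms(1-4)] c by (intro mult_left_mono) auto
  ultimately show thesis
    using that sat by force
qed

section \<open>Bundles allotted along an instance\<close>

lemma history_of_instance:
  assumes "online_mms_instance n m v" "i \<in> {1..n}"
  shows "map v [1..<Suc i] \<in> histories n m"
  using assms unfolding online_mms_instance_def histories_def by auto

lemma allotted_subset:
  assumes "online_algorithm n m D" "online_mms_instance n m v" "i \<in> {1..n}"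
  shows "allotted D v i \<subseteq> {1..m}"
  using assms(1) history_of_instance[OF assms(2,3)]
  unfolding online_algorithm_def allotted_def by blast

text \<open>Cutting the history of agent \<open>j\<close> to its first \<open>i\<close> entries
  gives the history of agent \<open>i\<close>, so the goods forbidden to \<open>j\<close> are
  exactly those handed out before.\<close>

lemma allotted_disjoint:
  assumes "online_algorithm n m D" "online_mms_instance n m v"
  shows "disjoint_family_on (allotted D v) {1..n}"
proof -
  have "allotted D v i \<inter> allotted D v j = {}" if j: "j \<in> {1..n}" and i: "1 \<le> i" "i < j" for i j
  proof -
    have len: "length (map v [1..<Suc j]) = j"
      by simp
    have "take i (map v [1..<Suc j]) = map v [1..<Suc i]"
      using i by (subst take_map, subst take_upt) auto
    moreover have "D (map v [1..<Suc j]) \<subseteq>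
        {1..m} - (\<Union>i\<in>{1..<j}. D (take i (map v [1..<Suc j])))"
      using assms(1) history_of_instance[OF assms(2) j] len unfolding online_algorithm_def by metis
    ultimately show ?thesis
      using i unfolding allotted_def by fastforce
  qed
  then show ?thesis
    unfolding disjoint_family_on_def
    by (metis Int_commute atLeastAtMost_iff linorder_neqE_nat)
qed

section \<open>Union bound over failure events\<close>

text \<open>The complements cover the space, so their probabilities sum to at least 1 and one of
  them is at least the average \<open>1 / card I\<close>.\<close>

lemma (in prob_space) ex_prob_le_if_Inter_empty:
  assumes "finite I" "I \<noteq> {}" "\<And>i. i \<in> I \<Longrightarrow> A i \<subseteq> space M" "(\<Inter>i\<in>I. A i) = {}"
  shows "\<exists>i\<in>I. prob (A i) \<le> 1 - 1 / card I"
proof (cases "\<forall>i\<in>I. A i \<in> events")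
  case True
  have "space M = (\<Union>i\<in>I. space M - A i)"
    using assms by blast
  then have "1 = prob (\<Union>i\<in>I. space M - A i)"
    using prob_space by simp
  also have "\<dots> \<le> (\<Sum>i\<in>I. prob (space M - A i))"
    using assms(1) True by (intro finite_measure_subadditive_finite) auto
  also have "\<dots> = (\<Sum>i\<in>I. 1 - prob (A i))"
    using True by (intro sum.cong) (auto simp: prob_compl)
  finally have sum: "1 \<le> (\<Sum>i\<in>I. 1 - prob (A i))" .
  show ?thesis
  proof (rule ccontr)
    assume "\<not> ?thesis"
    then have "(\<Sum>i\<in>I. 1 - prob (A i)) < (\<Sum>i\<in>I. 1 / real (card I))"
      using assms(1,2) by (intro sum_strict_mono) force+
    then show False
      using sum assms(1,2) by simp
  qed
next
  case False
  \<comment> \<open>A set outside the sigma-algebra has measure 0 by convention, and the bound is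
    non-negative because \<open>I\<close> is non-empty.\<close>
  then obtain i where "i \<in> I" "prob (A i) = 0"
    using measure_notin_sets by blast
  moreover have "1 \<le> card I"
    using assms(1,2) by (simp add: Suc_leI card_gt_0_iff)
  ultimately show ?thesis
    by (intro bexI[of _ i]) auto
qed

section \<open>The hard family on an n by n grid\<close>

definition row :: "nat \<Rightarrow> nat \<Rightarrow> nat set" where
  "row n j = {(j - 1) * n + 1..(j - 1) * n + n}"

lemma row_subset:
  assumes "j \<in> {1..n}"
  shows "row n j \<subseteq> {1..n * n}"
proof -
  have "(j - 1) * n + n = j * n"
    using assms by (cases j) auto
  also have "\<dots> \<le> n * n"
    using assms by simp
  finally show ?thesis
    unfolding row_def by auto
qed

lemma card_row [simp]: "card (row n j) = n"
  by (simp add: row_def)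

lemma finite_row [simp]: "finite (row n j)"
  by (simp add: row_def)

lemma disjoint_rows: "disjoint_family_on (row n) {1..n}"
proof -
  have "row n i \<inter> row n j = {}" if "1 \<le> i" "i < j" for i j
  proof -
    have "Suc (i - 1) * n \<le> (j - 1) * n"
      using that by (intro mult_le_mono1) auto
    then show ?thesis
      unfolding row_def by auto
  qed
  then show ?thesis
    unfolding disjoint_family_on_def
    by (metis Int_commute atLeastAtMost_iff linorder_neqE_nat)
qed

definition row_valuation :: "nat \<Rightarrow> valuation" where
  "row_valuation n = max_overlap n (n * n) (row n)"

text \<open>Good \<open>(j - 1) * n + l\<close> is the \<open>l\<close>-th good of row
  \<open>j\<close>. With singleton clauses the value is 1 if the bundle meets row \<open>j\<close>,
  and 0 otherwise.\<close>

definition unit_demand :: "nat \<Rightarrow> nat \<Rightarrow> valuation" where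
  "unit_demand n j = max_overlap n (n * n) (\<lambda>l. {(j - 1) * n + l})"

text \<open>The rows themselves form a partition into bundles worth \<open>n\<close>, so the maximin
  share is at least \<open>n\<close>.\<close>

lemma satisfied_row_valuation:
  assumes "1 \<le> n" "0 \<le> c" "S \<subseteq> {1..n * n}"
    and "c * mms n (n * n) (row_valuation n) \<le> row_valuation n S"
  obtains j where "j \<in> {1..n}" "c * real n \<le> real (card (S \<inter> row n j))"
proof -
  have "\<exists>j\<in>{1..n}. c * real n \<le> real (card (S \<inter> row n j))"
  proof (rule satisfied_overlap)
    show "c * mms n (n * n) (max_overlap n (n * n) (row n)) \<le> max_overlap n (n * n) (row n) S"
      using assms(4) by (simp add: row_valuation_def)
    show "disjoint_family_on (row n) {1..n}"
      by (rule disjoint_rows)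
    show "n \<le> card (row n l)" for l
      by simp
    show "row n l \<subseteq> {1..n * n}" if "l \<in> {1..n}" for l
      by (rule row_subset[OF that])
  qed (use assms(1-3) in auto)
  then show thesis
    using that by blast
qed

text \<open>Each of the \<open>n\<close> bundles can receive one good of row \<open>j\<close>, so
  the maximin share is at least 1 and any \<open>c > 0\<close> requires positive value.\<close>

lemma satisfied_unit_demand:
  assumes "j \<in> {1..n}" "0 < c" "S \<subseteq> {1..n * n}"
    and "c * mms n (n * n) (unit_demand n j) \<le> unit_demand n j S"
  shows "S \<inter> row n j \<noteq> {}"
proof -
  let ?F = "\<lambda>l. {(j - 1) * n + l}"
  have in_row: "?F l \<subseteq> row n j" if "l \<in> {1..n}" for l
    using that by (auto simp: row_def)
  obtain l where l: "l \<in> {1..n}" "c * real 1 \<le> real (card (S \<inter> ?F l))"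
  proof (rule satisfied_overlap)
    show "c * mms n (n * n) (max_overlap n (n * n) ?F) \<le> max_overlap n (n * n) ?F S"
      using assms(4) by (simp add: unit_demand_def)
    show "disjoint_family_on ?F {1..n}"
      by (simp add: disjoint_family_on_def)
    show "?F l \<subseteq> {1..n * n}" if "l \<in> {1..n}" for l
      using in_row[OF that] row_subset[OF assms(1)] by blast
    show "1 \<le> card (?F l)" for l
      by simp
    show "1 \<le> n" "0 \<le> c"
      using assms(1,2) by auto
  qed (use assms(3) in auto)
  then have "S \<inter> ?F l \<noteq> {}"
    using assms(2) by fastforce
  then show ?thesis
    using in_row[OF l(1)] by blast
qed

text \<open>The parameter \<open>j\<close> is what the adversary hides: it first shows in the
  valuation of agent 2.\<close>

definition row_instance :: "nat \<Rightarrow> nat \<Rightarrow> nat \<Rightarrow> valuation" where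
  "row_instance n j i = (if i = 1 then row_valuation n else unit_demand n j)"

lemma row_instance:
  assumes "1 \<le> n"
  shows "online_mms_instance n (n * n) (row_instance n j)"
    and "binary_xos (n * n) (row_instance n j i)"
proof -
  have eq: "row_instance n j i =
      max_overlap n (n * n) (if i = 1 then row n else (\<lambda>l. {(j - 1) * n + l}))" for i
    unfolding row_instance_def row_valuation_def unit_demand_def by (cases "i = 1") simp_all
  show "online_mms_instance n (n * n) (row_instance n j)"
    unfolding online_mms_instance_def eq using assms max_overlap_valuation[OF assms] by blast
  show "binary_xos (n * n) (row_instance n j i)"
    unfolding eq by (rule max_overlap_binary_xos[OF assms])
qed

text \<open>Agents 2 to \<open>n\<close> hold disjoint bundles that each meet row \<open>j\<close>.
  They use up at least \<open>n - 1\<close> of its \<open>n\<close> goods, leaving at most one for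
  agent 1.\<close>

lemma row_instance_card_le:
  assumes j: "j \<in> {1..n}" and c: "0 < c" and D: "online_algorithm n (n * n) D"
    and sat: "\<forall>i\<in>{1..n}. c * mms n (n * n) (row_instance n j i)
      \<le> row_instance n j i (allotted D (row_instance n j) i)"
  shows "card (allotted D (row_instance n j) 1 \<inter> row n j) \<le> 1"
proof -
  define A where "A = allotted D (row_instance n j)"
  have n: "1 \<le> n"
    using j by simp
  note inst = row_instance(1)[OF n, of j]
  have disj: "disjoint_family_on A {1..n}"
    unfolding A_def by (rule allotted_disjoint[OF D inst])
  have "1 \<le> card (A i \<inter> row n j)" if i: "i \<in> {2..n}" for i
  proof -
    have "A i \<subseteq> {1..n * n}"
      using allotted_subset[OF D inst] i unfolding A_def by auto
    moreover have "c * mms n (n * n) (unit_demand n j) \<le> unit_demand n j (A i)"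
      using sat i unfolding A_def row_instance_def by (auto dest!: bspec[of _ _ i])
    ultimately have "A i \<inter> row n j \<noteq> {}"
      using satisfied_unit_demand[OF j c] by blast
    then show ?thesis
      by (simp add: Suc_leI card_gt_0_iff)
  qed
  then have "(\<Sum>i\<in>{2..n}. 1) \<le> (\<Sum>i\<in>{2..n}. card (A i \<inter> row n j))"
    by (intro sum_mono)
  moreover have "(\<Sum>i\<in>{1..n}. card (A i \<inter> row n j)) = card (\<Union>i\<in>{1..n}. A i \<inter> row n j)"
    using disj by (subst card_UN_disjoint) (auto simp: disjoint_family_on_def)
  moreover have "\<dots> \<le> card (row n j)"
    by (intro card_mono) auto
  moreover have "(\<Sum>i\<in>{1..n}. card (A i \<inter> row n j))
      = card (A 1 \<inter> row n j) + (\<Sum>i\<in>{2..n}. card (A i \<inter> row n j))"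
    using n by (simp add: sum.atLeast_Suc_atMost numeral_2_eq_2)
  ultimately show ?thesis
    using n unfolding A_def[symmetric] by simp
qed

text \<open>No single \<open>D\<close> lies in all success events \<open>E j\<close>: the first
  bundle contains two goods of some row, and \<open>D\<close> fails for that row. The union bound
  over the \<open>n\<close> rows then applies.\<close>

lemma row_instance_prob_le:
  assumes n: "1 \<le> n" and c: "0 < c" "1 < c * real n" and M: "randomized_algorithm n (n * n) M"
  shows "\<exists>j\<in>{1..n}. measure M {D \<in> space M. \<forall>i\<in>{1..n}. c * mms n (n * n) (row_instance n j i)
      \<le> row_instance n j i (allotted D (row_instance n j) i)} \<le> 1 - 1 / real n"
proof -
  interpret prob_space M
    using M unfolding randomized_algorithm_def by simp
  define E where "E j = {D \<in> space M. \<forall>i\<in>{1..n}. c * mms n (n * n) (row_instance n j i)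
      \<le> row_instance n j i (allotted D (row_instance n j) i)}" for j
  have False if inE: "\<And>j. j \<in> {1..n} \<Longrightarrow> D \<in> E j" for D
  proof -
    have D: "online_algorithm n (n * n) D"
      using inE[of 1] n M unfolding E_def randomized_algorithm_def by auto
    define S where "S = D [row_valuation n]"
    \<comment> \<open>Agent 1 is served on a history of length one, which is the same for every
      \<open>j\<close>.\<close>
    have S: "allotted D (row_instance n j) 1 = S" for j
      by (simp add: S_def allotted_def row_instance_def)
    have "S \<subseteq> {1..n * n}"
      using allotted_subset[OF D row_instance(1)[OF n, of 1], of 1] n unfolding S by simp
    moreover have "c * mms n (n * n) (row_valuation n) \<le> row_valuation n S"
    proof -
      have "c * mms n (n * n) (row_instance n 1 1)
          \<le> row_instance n 1 1 (allotted D (row_instance n 1) 1)"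
        using inE[of 1] n unfolding E_def by simp
      then show ?thesis
        unfolding S by (simp add: row_instance_def)
    qed
    ultimately obtain j where j: "j \<in> {1..n}" "c * real n \<le> real (card (S \<inter> row n j))"
      using satisfied_row_valuation[of n c S] n c by auto
    have "card (S \<inter> row n j) \<le> 1"
      using row_instance_card_le[OF j(1) c(1) D] inE[OF j(1)] unfolding E_def S by blast
    then show False
      using j(2) c(2) by linarith
  qed
  then have "(\<Inter>j\<in>{1..n}. E j) = {}"
    by blast
  then have "\<exists>j\<in>{1..n}. prob (E j) \<le> 1 - 1 / real (card {1..n})"
    using n by (intro ex_prob_le_if_Inter_empty) (auto simp: E_def)
  then show ?thesis
    by (simp add: E_def)
qed

section \<open>Rows against columns for two agents\<close>

definition column_valuation :: valuation where
  "column_valuation = max_overlap 2 (2 * 2) (\<lambda>l. {l, l + 2})"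

text \<open>With factor 1, one agent needs a whole row of the 2 by 2 grid and the other a whole
  column, but every row crosses every column.\<close>

lemma rows_columns_conflict:
  assumes "S \<subseteq> {1..2 * 2}" "T \<subseteq> {1..2 * 2}" "S \<inter> T = {}"
    and "1 * mms 2 (2 * 2) (row_valuation 2) \<le> row_valuation 2 S"
    and "1 * mms 2 (2 * 2) column_valuation \<le> column_valuation T"
  shows False
proof -
  obtain j where j: "j \<in> {1..2}" "2 \<le> card (S \<inter> row 2 j)"
    using satisfied_row_valuation[of 2 1 S] assms by auto
  let ?C = "\<lambda>l::nat. {l, l + 2}"
  have "\<exists>l\<in>{1..2}. 1 * real 2 \<le> real (card (T \<inter> ?C l))"
  proof (rule satisfied_overlap)
    show "1 * mms 2 (2 * 2) (max_overlap 2 (2 * 2) ?C) \<le> max_overlap 2 (2 * 2) ?C T"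
      using assms(5) by (simp only: column_valuation_def)
    show "disjoint_family_on ?C {1..2}"
      by (auto simp: disjoint_family_on_def)
    show "2 \<le> card (?C l)" for l
      by simp
    show "T \<subseteq> {1..2 * 2}"
      by (rule assms(2))
  qed auto
  then obtain l where l: "l \<in> {1..2}" "2 \<le> card (T \<inter> ?C l)"
    by auto
  \<comment> \<open>Meeting a two-element set in at least two goods means containing it.\<close>
  have "S \<inter> row 2 j = row 2 j"
    using j(2) by (intro card_seteq) auto
  moreover have "T \<inter> {l, l + 2} = {l, l + 2}"
    using l(2) by (intro card_seteq) auto
  \<comment> \<open>This good is the cell where row \<open>j\<close> and column \<open>l\<close>
    cross.\<close>
  moreover have "(j - 1) * 2 + l \<in> row 2 j \<inter> {l, l + 2}"
    using j(1) l(1) unfolding row_def by (auto simp: numeral_2_eq_2 le_Suc_eq)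
  ultimately show False
    using assms(3) by blast
qed

text \<open>The order of quantifiers encodes the information model: \<open>n\<close> and
  \<open>m\<close> come before \<open>M\<close>, as the algorithm knows them, while \<open>v\<close>
  may depend on the distribution \<open>M\<close> but not on the drawn \<open>D\<close>.\<close>

theorem theorem7p16:
  fixes c :: real
  assumes "0 < c" and "c \<le> 1"
  shows "\<exists>n m :: nat. 1 \<le> n \<and>
    (\<forall>M. randomized_algorithm n m M \<longrightarrow>
      (\<exists>v. online_mms_instance n m v \<and> (\<forall>i\<in>{1..n}. binary_xos m (v i)) \<and>
        (\<forall>\<beta>. 1 - c / 2 \<le> \<beta> \<longrightarrow> \<not> competitive_on n m v M c \<beta>)))"
proof (cases "c = 1")
  case True
  define v :: "nat \<Rightarrow> valuation" where
    "v i = (if i = 1 then row_valuation 2 else column_valuation)" for i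
  have inst: "online_mms_instance 2 (2 * 2) v"
    using max_overlap_valuation[of 2]
    unfolding online_mms_instance_def v_def row_valuation_def column_valuation_def by auto
  have xos: "\<forall>i\<in>{1..2}. binary_xos (2 * 2) (v i)"
    using max_overlap_binary_xos[of 2] unfolding v_def row_valuation_def column_valuation_def by auto
  have "\<not> competitive_on 2 (2 * 2) v M c \<beta>"
    if M: "randomized_algorithm 2 (2 * 2) M" and \<beta>: "1 - c / 2 \<le> \<beta>" for M \<beta>
  proof -
    have "\<not> (\<forall>i\<in>{1..2}. c * mms 2 (2 * 2) (v i) \<le> v i (allotted D v i))" if "D \<in> space M" for D
    proof
      assume sat: "\<forall>i\<in>{1..2}. c * mms 2 (2 * 2) (v i) \<le> v i (allotted D v i)"
      have D: "online_algorithm 2 (2 * 2) D"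
        using M that unfolding randomized_algorithm_def by blast
      show False
      proof (rule rows_columns_conflict)
        show "allotted D v 1 \<inter> allotted D v 2 = {}"
          using allotted_disjoint[OF D inst] unfolding disjoint_family_on_def by auto
        show "1 * mms 2 (2 * 2) (row_valuation 2) \<le> row_valuation 2 (allotted D v 1)"
          using bspec[OF sat, of 1] True by (simp add: v_def)
        show "1 * mms 2 (2 * 2) column_valuation \<le> column_valuation (allotted D v 2)"
          using bspec[OF sat, of 2] True by (simp add: v_def)
      qed (use allotted_subset[OF D inst] in auto)
    qed
    \<comment> \<open>Success has probability 0, whereas \<open>\<beta>\<close> is at least
      1/2.\<close>
    then have "{D \<in> space M. \<forall>i\<in>{1..2}. c * mms 2 (2 * 2) (v i) \<le> v i (allotted D v i)} = {}"
      by blast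
    then show ?thesis
      using \<beta> True unfolding competitive_on_def by (simp only: measure_empty)
  qed
  then show ?thesis
    using inst xos by (intro exI[of _ 2] exI[of _ "2 * 2"]) auto
next
  case False
  \<comment> \<open>This is the least integer above \<open>1 / c\<close>. It gives
    \<open>c * n > 1\<close>, and \<open>n \<le> 1 / c + 1 < 2 / c\<close> since
    \<open>c < 1\<close>, so \<open>1 / n\<close> strictly exceeds \<open>c / 2\<close>.\<close>
  define n where "n = nat \<lfloor>1 / c\<rfloor> + 1"
  have n: "1 \<le> n"
    by (simp add: n_def)
  have "0 \<le> \<lfloor>1 / c\<rfloor>"
    using assms(1) by simp
  then have n_real: "real n = of_int \<lfloor>1 / c\<rfloor> + 1"
    by (simp add: n_def)
  have "1 / c < real n" "real n \<le> 1 / c + 1"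
    unfolding n_real by linarith+
  moreover have "1 < 1 / c"
    using assms False by simp
  ultimately have cn: "1 < c * real n" "real n < 2 / c"
    using assms(1) by (auto simp: field_simps)
  have "c / 2 < 1 / real n"
    using cn(2) n assms(1) by (simp add: field_simps)
  have "\<exists>j. \<forall>\<beta>. 1 - c / 2 \<le> \<beta> \<longrightarrow> \<not> competitive_on n (n * n) (row_instance n j) M c \<beta>"
    if M: "randomized_algorithm n (n * n) M" for M
  proof -
    obtain j where "measure M {D \<in> space M. \<forall>i\<in>{1..n}. c * mms n (n * n) (row_instance n j i)
        \<le> row_instance n j i (allotted D (row_instance n j) i)} \<le> 1 - 1 / real n"
      using row_instance_prob_le[OF n assms(1) cn(1) M] by blast
    then show ?thesis
      using \<open>c / 2 < 1 / real n\<close> unfolding competitive_on_def by (intro exI[of _ j]) linarith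
  qed
  then show ?thesis
    using row_instance[OF n] n by (intro exI[of _ n] exI[of _ "n * n"]) blast
qed

end
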